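(* Let $G \leq \mathrm{GL}(k;\mathbb{R})$ be a compact Lie group, let $V = \mathbb{R}^n$, and let $\mathcal{M} \subseteq V$ be a smooth embedded submanifold of $\mathbb{R}^n$ that is compact as a subset of $V$. Let $\pi' : G \times \mathcal{M} \to \mathcal{M}$ be a continuous group action that is smooth, free and proper, and suppose that the orbit space $\mathcal{M}/G$ is simply connected. Then $\pi'$, restricted to any bounded subset of $G$, can be approximated by a decomposition $\psi \circ \pi(g) \circ \phi$ in the following sense: for every bounded subset $B \subseteq G$ and every $\epsilon > 0$ there exist a latent dimension $d \in \mathbb{N}$, a linear group representation $\pi : G \to \mathrm{GL}(d;\mathbb{R})$, and neural networks $\phi : \mathbb{R}^n \to \mathbb{R}^d$ and $\psi : \mathbb{R}^d \to \mathbb{R}^n$, each with one hidden layer of arbitrary finite width and not depending on $g$, such that $$\sup_{g \in B}\ \sup_{v \in \mathcal{M}} \left\| \pi'(g, v) - \psi\big(\pi(g)\,\phi(v)\big) \right\| \leq \epsilon .$$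
   Context: A one-hidden-layer neural network $\mathbb{R}^a \to \mathbb{R}^b$ of width $w$ is a function of the form $x \mapsto W_2\,\sigma(W_1 x + b_1) + b_2$ with $W_1 \in \mathbb{R}^{w \times a}$, $b_1 \in \mathbb{R}^w$, $W_2 \in \mathbb{R}^{b \times w}$, $b_2 \in \mathbb{R}^b$, where $\sigma$ is the ReLU function $t \mapsto \max(t,0)$ applied entrywise; "arbitrary width" means that $w$ may be any positive integer. A linear group representation $\pi : G \to \mathrm{GL}(d;\mathbb{R})$ is a continuous group homomorphism, acting on $\mathbb{R}^d$ by matrix multiplication. "Bounded subset of $G$" means bounded as a set of matrices in $\mathbb{R}^{k \times k}$. Simply connected means path-connected with trivial fundamental group. The orbit space $\mathcal{M}/G$ carries the quotient topology. *)

theory Defs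
  imports
    "HOL-Analysis.Analysis"
    "HOL-Algebra.Group"
    "Jordan_Normal_Form.Matrix"
begin

hide_const (open) Matrix.mat Matrix.vec
no_notation Matrix.scalar_prod (infix "\<bullet>" 70)
no_notation Matrix.vec_index (infixl "$" 100)

section \<open>Smooth maps and embedded submanifolds of Euclidean spaces\<close>

text \<open>The k-th order notion is only meant for open sets S, where the Frechet derivative at a
  point of S depends only on the values on S.\<close>

primrec Ck_on :: "nat \<Rightarrow> 'a::euclidean_space set \<Rightarrow> ('a \<Rightarrow> 'b::euclidean_space) \<Rightarrow> bool" where
  "Ck_on 0 S f \<longleftrightarrow> continuous_on S f"
| "Ck_on (Suc k) S f \<longleftrightarrow> (\<forall>x\<in>S. f differentiable (at x)) \<and>
     (\<forall>v. Ck_on k S (\<lambda>x. frechet_derivative f (at x) v))"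

definition smooth_on_open :: "'a::euclidean_space set \<Rightarrow> ('a \<Rightarrow> 'b::euclidean_space) \<Rightarrow> bool" where
  "smooth_on_open S f \<longleftrightarrow> open S \<and> (\<forall>k. Ck_on k S f)"

text \<open>Smoothness on an arbitrary subset of a Euclidean space: local extendability to a smooth map
  on an open subset of the ambient space. On an embedded submanifold this is
  smoothness in charts.\<close>

definition smooth_map_on :: "'a::euclidean_space set \<Rightarrow> ('a \<Rightarrow> 'b::euclidean_space) \<Rightarrow> bool" where
  "smooth_map_on S f \<longleftrightarrow>
     (\<forall>x\<in>S. \<exists>U F. x \<in> U \<and> smooth_on_open U F \<and> (\<forall>y \<in> S \<inter> U. F y = f y))"

definition diffeomorphism ::
  "'a::euclidean_space set \<Rightarrow> 'b::euclidean_space set \<Rightarrow> ('a \<Rightarrow> 'b) \<Rightarrow> ('b \<Rightarrow> 'a) \<Rightarrow> bool" where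
  "diffeomorphism U V h h' \<longleftrightarrow>
     homeomorphism U V h h' \<and> smooth_on_open U h \<and> smooth_on_open V h'"

text \<open>Slice charts: around each point, a diffeomorphism between open sets of the ambient
  space flattens M onto an m-dimensional linear subspace.\<close>

definition embedded_submanifold :: "nat \<Rightarrow> 'a::euclidean_space set \<Rightarrow> bool" where
  "embedded_submanifold m M \<longleftrightarrow>
     (\<forall>p\<in>M. \<exists>(U::'a set) (V::'a set) h h' S. p \<in> U \<and> diffeomorphism U V h h' \<and>
        subspace S \<and> dim S = m \<and> h ` (U \<inter> M) = V \<inter> S)"


section \<open>Matrix groups and linear representations\<close>

definition GL :: "(real^'k^'k) monoid" where
  "GL = \<lparr>carrier = {A. invertible A}, mult = (**), one = mat 1\<rparr>"

definition GL_mat :: "nat \<Rightarrow> real mat monoid" where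
  "GL_mat d = \<lparr>carrier = {A \<in> carrier_mat d d. invertible_mat A}, mult = (*), one = 1\<^sub>m d\<rparr>"

lemma invertible_one: "invertible (mat 1 :: real^'k^'k)"
  unfolding invertible_def by (rule exI[of _ "mat 1"]) simp

lemma group_GL: "group GL"
proof (rule groupI)
  fix x :: "real^'k^'k" assume "x \<in> carrier GL"
  then obtain y where "x ** y = mat 1" "y ** x = mat 1"
    by (auto simp: GL_def invertible_def)
  then show "\<exists>y\<in>carrier GL. y \<otimes>\<^bsub>GL\<^esub> x = \<one>\<^bsub>GL\<^esub>"
    by (intro bexI[of _ y]) (auto simp: GL_def invertible_def)
qed (auto simp: GL_def invertible_mult invertible_one matrix_mul_assoc)

lemma carrier_GL_mat_iff:
  "x \<in> carrier (GL_mat d) \<longleftrightarrow>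
     x \<in> carrier_mat d d \<and> (\<exists>y\<in>carrier_mat d d. x * y = 1\<^sub>m d \<and> y * x = 1\<^sub>m d)"
proof
  assume x: "x \<in> carrier (GL_mat d)"
  then obtain y where y: "x * y = 1\<^sub>m (dim_row x)" "y * x = 1\<^sub>m (dim_row y)"
    by (auto simp: GL_mat_def invertible_mat_def inverts_mat_def)
  have xc: "x \<in> carrier_mat d d" using x by (simp add: GL_mat_def)
  have "dim_col y = d" using arg_cong[OF y(1), of dim_col] xc by simp
  moreover have "dim_row y = d" using arg_cong[OF y(2), of dim_col] xc by simp
  ultimately show "x \<in> carrier_mat d d \<and> (\<exists>y\<in>carrier_mat d d. x * y = 1\<^sub>m d \<and> y * x = 1\<^sub>m d)"
    using xc y by auto
next
  assume "x \<in> carrier_mat d d \<and> (\<exists>y\<in>carrier_mat d d. x * y = 1\<^sub>m d \<and> y * x = 1\<^sub>m d)"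
  then show "x \<in> carrier (GL_mat d)"
    by (auto simp: GL_mat_def invertible_mat_def inverts_mat_def)
qed

lemma group_GL_mat: "group (GL_mat d)"
proof (rule groupI)
  fix x y assume "x \<in> carrier (GL_mat d)" "y \<in> carrier (GL_mat d)"
  then obtain x' y' where c: "x \<in> carrier_mat d d" "y \<in> carrier_mat d d"
      "x' \<in> carrier_mat d d" "y' \<in> carrier_mat d d"
    and i: "x * x' = 1\<^sub>m d" "x' * x = 1\<^sub>m d" "y * y' = 1\<^sub>m d" "y' * y = 1\<^sub>m d"
    by (auto simp: carrier_GL_mat_iff)
  have "(x * y) * (y' * x') = x * ((y * y') * x')"
    using c by (simp add: assoc_mult_mat[of _ d d _ d _ d])
  moreover have "(y' * x') * (x * y) = y' * ((x' * x) * y)"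
    using c by (simp add: assoc_mult_mat[of _ d d _ d _ d])
  ultimately have "(x * y) * (y' * x') = 1\<^sub>m d" "(y' * x') * (x * y) = 1\<^sub>m d"
    using c i by simp_all
  then have "x * y \<in> carrier (GL_mat d)"
    unfolding carrier_GL_mat_iff using c by (intro conjI bexI[of _ "y' * x'"]) auto
  then show "x \<otimes>\<^bsub>GL_mat d\<^esub> y \<in> carrier (GL_mat d)"
    by (simp add: GL_mat_def)
next
  fix x assume "x \<in> carrier (GL_mat d)"
  then obtain y where "y \<in> carrier (GL_mat d)" "y * x = 1\<^sub>m d"
    unfolding carrier_GL_mat_iff by blast
  then show "\<exists>y\<in>carrier (GL_mat d). y \<otimes>\<^bsub>GL_mat d\<^esub> x = \<one>\<^bsub>GL_mat d\<^esub>"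
    by (intro bexI[of _ y]) (simp_all add: GL_mat_def)
next
  have "1\<^sub>m d \<in> carrier (GL_mat d)"
    unfolding carrier_GL_mat_iff by (intro conjI bexI[of _ "1\<^sub>m d"]) auto
  then show "\<one>\<^bsub>GL_mat d\<^esub> \<in> carrier (GL_mat d)"
    by (simp add: GL_mat_def)
qed (auto simp: GL_mat_def)

text \<open>Multiplication and inversion on an embedded submanifold of GL that is a subgroup are
  restrictions of rational maps of the matrix entries, so their smoothness is automatic.\<close>

definition matrix_Lie_group :: "(real^'k^'k) set \<Rightarrow> bool" where
  "matrix_Lie_group G \<longleftrightarrow> subgroup G GL \<and> (\<exists>m. embedded_submanifold m G)"

text \<open>The matrix type of unfixed dimension carries no topology; continuity is entrywise.\<close>

definition linear_representation ::
  "(real^'k^'k) set \<Rightarrow> nat \<Rightarrow> (real^'k^'k \<Rightarrow> real mat) \<Rightarrow> bool" where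
  "linear_representation G d \<rho> \<longleftrightarrow>
     \<rho> \<in> hom (GL\<lparr>carrier := G\<rparr>) (GL_mat d) \<and>
     (\<forall>i<d. \<forall>j<d. continuous_on G (\<lambda>g. \<rho> g $$ (i, j)))"


section \<open>Group actions and orbit spaces\<close>

definition matrix_group_action ::
  "(real^'k^'k) set \<Rightarrow> 'a set \<Rightarrow> ((real^'k^'k) \<times> 'a \<Rightarrow> 'a) \<Rightarrow> bool" where
  "matrix_group_action G M act \<longleftrightarrow>
     (\<forall>g\<in>G. \<forall>v\<in>M. act (g, v) \<in> M) \<and>
     (\<forall>v\<in>M. act (mat 1, v) = v) \<and>
     (\<forall>g\<in>G. \<forall>h\<in>G. \<forall>v\<in>M. act (g ** h, v) = act (g, act (h, v)))"

definition free_action ::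
  "(real^'k^'k) set \<Rightarrow> 'a set \<Rightarrow> ((real^'k^'k) \<times> 'a \<Rightarrow> 'a) \<Rightarrow> bool" where
  "free_action G M act \<longleftrightarrow>
     (\<forall>g\<in>G. \<forall>v\<in>M. act (g, v) = v \<longrightarrow> g = mat 1)"

definition proper_action ::
  "(real^'k^'k) set \<Rightarrow> 'a::topological_space set \<Rightarrow> ((real^'k^'k) \<times> 'a \<Rightarrow> 'a) \<Rightarrow> bool" where
  "proper_action G M act \<longleftrightarrow>
     proper_map (top_of_set (G \<times> M)) (top_of_set (M \<times> M)) (\<lambda>(g, v). (act (g, v), v))"

definition action_orbit ::
  "(real^'k^'k) set \<Rightarrow> ((real^'k^'k) \<times> 'a \<Rightarrow> 'a) \<Rightarrow> 'a \<Rightarrow> 'a set" where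
  "action_orbit G act v = (\<lambda>g. act (g, v)) ` G"

definition quotient_topology :: "'a topology \<Rightarrow> ('a \<Rightarrow> 'b) \<Rightarrow> 'b topology" where
  "quotient_topology X q =
     topology (\<lambda>U. U \<subseteq> q ` topspace X \<and> openin X {x \<in> topspace X. q x \<in> U})"

definition orbit_space ::
  "(real^'k^'k) set \<Rightarrow> 'a::topological_space set \<Rightarrow> ((real^'k^'k) \<times> 'a \<Rightarrow> 'a) \<Rightarrow> 'a set topology"
  where
  "orbit_space G M act = quotient_topology (top_of_set M) (action_orbit G act)"

lemma openin_quotient_topology:
  "openin (quotient_topology X q) U \<longleftrightarrow>
     U \<subseteq> q ` topspace X \<and> openin X {x \<in> topspace X. q x \<in> U}"
proof -
  have "istopology (\<lambda>U. U \<subseteq> q ` topspace X \<and> openin X {x \<in> topspace X. q x \<in> U})"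
    unfolding istopology_def
  proof (intro conjI allI impI)
    fix S T
    assume S: "S \<subseteq> q ` topspace X \<and> openin X {x \<in> topspace X. q x \<in> S}"
      and T: "T \<subseteq> q ` topspace X \<and> openin X {x \<in> topspace X. q x \<in> T}"
    show "S \<inter> T \<subseteq> q ` topspace X" using S by blast
    have "{x \<in> topspace X. q x \<in> S \<inter> T} =
        {x \<in> topspace X. q x \<in> S} \<inter> {x \<in> topspace X. q x \<in> T}" by blast
    then show "openin X {x \<in> topspace X. q x \<in> S \<inter> T}" using S T by (simp add: openin_Int)
  next
    fix K
    assume K: "\<forall>S\<in>K. S \<subseteq> q ` topspace X \<and> openin X {x \<in> topspace X. q x \<in> S}"
    then show "\<Union> K \<subseteq> q ` topspace X" by blast
    have "{x \<in> topspace X. q x \<in> \<Union> K} = (\<Union>S\<in>K. {x \<in> topspace X. q x \<in> S})" by blast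
    then show "openin X {x \<in> topspace X. q x \<in> \<Union> K}" using K by auto
  qed
  then show ?thesis by (simp add: quotient_topology_def topology_inverse')
qed

lemma topspace_quotient_topology: "topspace (quotient_topology X q) = q ` topspace X"
proof
  show "topspace (quotient_topology X q) \<subseteq> q ` topspace X"
    by (rule conjunct1[OF iffD1[OF openin_quotient_topology openin_topspace]])
  have "{x \<in> topspace X. q x \<in> q ` topspace X} = topspace X" by blast
  then have "openin (quotient_topology X q) (q ` topspace X)"
    by (simp add: openin_quotient_topology)
  then show "q ` topspace X \<subseteq> topspace (quotient_topology X q)" by (rule openin_subset)
qed

lemma quotient_map_quotient_topology: "quotient_map X (quotient_topology X q) q"
  by (simp add: quotient_map_def topspace_quotient_topology openin_quotient_topology)

text \<open>The library's simply-connectedness predicate applies to subsets of a topological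
  space type only; this is the version for abstract topologies.\<close>

definition simply_connected_space :: "'a topology \<Rightarrow> bool" where
  "simply_connected_space X \<longleftrightarrow>
     path_connected_space X \<and>
     (\<forall>x \<in> topspace X. \<forall>p. pathin X p \<and> p 0 = x \<and> p 1 = x \<longrightarrow>
        homotopic_with (\<lambda>r. r 0 = x \<and> r 1 = x) (top_of_set {0..1}) X p (\<lambda>_. x))"


section \<open>One-hidden-layer ReLU networks\<close>

definition relu :: "real \<Rightarrow> real" where
  "relu t = max t 0"

definition one_hidden_layer_network :: "nat \<Rightarrow> nat \<Rightarrow> (real vec \<Rightarrow> real vec) \<Rightarrow> bool" where
  "one_hidden_layer_network a b f \<longleftrightarrow>
     (\<exists>w>0. \<exists>W\<^sub>1 \<in> carrier_mat w a. \<exists>b\<^sub>1 \<in> carrier_vec w. \<exists>W\<^sub>2 \<in> carrier_mat b w. \<exists>b\<^sub>2 \<in> carrier_vec b.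
        \<forall>x \<in> carrier_vec a. f x = W\<^sub>2 *\<^sub>v map_vec relu (W\<^sub>1 *\<^sub>v x + b\<^sub>1) + b\<^sub>2)"

text \<open>Identification of the n-dimensional space indexed by a finite type with the vectors of
  dimension n, through the library's enumeration of a finite set. Which enumeration is used is
  immaterial, since the class of networks is closed under permuting input and output
  coordinates.\<close>

definition to_coords :: "real^'n \<Rightarrow> real vec" where
  "to_coords x = Matrix.vec CARD('n) (\<lambda>i. vec_nth x (from_nat_into (UNIV :: 'n set) i))"

definition of_coords :: "real vec \<Rightarrow> real^'n" where
  "of_coords y = (\<chi> i. vec_index y (to_nat_on (UNIV :: 'n set) i))"

lemma to_nat_on_UNIV_less: "to_nat_on (UNIV :: 'n::finite set) i < CARD('n)"
  using to_nat_on_finite[of "UNIV :: 'n set"] by (auto simp: bij_betw_def)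

lemma to_coords_carrier: "to_coords (x :: real^'n) \<in> carrier_vec CARD('n)"
  by (simp add: to_coords_def)

lemma of_coords_to_coords: "of_coords (to_coords x) = (x :: real^'n)"
  by (simp add: vec_eq_iff of_coords_def to_coords_def to_nat_on_UNIV_less)

lemma to_coords_of_coords:
  assumes "y \<in> carrier_vec CARD('n)"
  shows "to_coords (of_coords y :: real^'n) = y"
proof (rule eq_vecI)
  show "dim_vec (to_coords (of_coords y :: real^'n)) = dim_vec y"
    using assms by (simp add: to_coords_def)
  fix i assume "i < dim_vec y"
  then have i: "i < CARD('n)" using assms by simp
  then have "to_nat_on (UNIV :: 'n set) (from_nat_into UNIV i) = i"
    using bij_betw_from_nat_into_finite[of "UNIV :: 'n set"]
      to_nat_on_finite[of "UNIV :: 'n set"]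
    by (simp add: from_nat_into_def bij_betw_def inv_into_into f_inv_into_f)
  then show "vec_index (to_coords (of_coords y :: real^'n)) i = vec_index y i"
    using i by (simp add: to_coords_def of_coords_def)
qed

end

theory Submission
  imports Defs
begin

text \<open>Approximate the whole map (g, v) \<mapsto> \<pi>'(g, v) on the compact set G \<times> M. Entries of
  representations of G multiply like entries of Kronecker products, so by Stone--Weierstrass
  finite sums of products \<rho>(g)_ij exp(a \<bullet> v) are dense there. Each exponential is approximated by
  a piecewise linear ReLU network evaluated at v, and taking the direct sum of the
  representations that occur turns the whole sum into a linear readout W (\<pi>(g) \<phi>(v)). The
  linear map W is itself a ReLU network, since t = relu t - relu (- t).\<close>

subsection \<open>Linear representations\<close>

text \<open>Invertibility of \<open>\<rho> g\<close> comes for free: the inverse \<open>h\<close> of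
  \<open>g\<close> lies in \<open>G\<close>, and \<open>\<rho> h\<close> inverts
  \<open>\<rho> g\<close> by multiplicativity and the value at the identity.\<close>

lemma linear_representationI:
  assumes G: "subgroup G GL"
    and carrier: "\<And>g. g \<in> G \<Longrightarrow> \<rho> g \<in> carrier_mat d d"
    and one: "\<rho> (mat 1) = 1\<^sub>m d"
    and mult: "\<And>g h. g \<in> G \<Longrightarrow> h \<in> G \<Longrightarrow> \<rho> (g ** h) = \<rho> g * \<rho> h"
    and cont: "\<And>i j. i < d \<Longrightarrow> j < d \<Longrightarrow> continuous_on G (\<lambda>g. \<rho> g $$ (i, j))"
  shows "linear_representation G d \<rho>"
proof -
  have "\<rho> g \<in> carrier (GL_mat d)" if g: "g \<in> G" for g
  proof -
    obtain h where h: "h \<in> G" "h ** g = mat 1" "g ** h = mat 1"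
    proof
      show "inv\<^bsub>GL\<^esub> g \<in> G" using subgroup.m_inv_closed[OF G g] .
      have "g \<in> carrier GL" using subgroup.subset[OF G] g by blast
      then show "inv\<^bsub>GL\<^esub> g ** g = mat 1" "g ** inv\<^bsub>GL\<^esub> g = mat 1"
        using group.l_inv[OF group_GL, of g] group.r_inv[OF group_GL, of g]
        by (simp_all add: GL_def)
    qed
    then show ?thesis
      unfolding carrier_GL_mat_iff using carrier[OF g] carrier[OF h(1)] mult[OF g h(1)] mult[OF h(1) g] one
      by (metis)
  qed
  then show ?thesis
    unfolding linear_representation_def using mult cont
    by (auto simp: hom_def GL_def GL_mat_def)
qed

lemma linear_representationD:
  assumes G: "subgroup G GL" and \<rho>: "linear_representation G d \<rho>"
  shows "g \<in> G \<Longrightarrow> \<rho> g \<in> carrier_mat d d"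
    and "\<rho> (mat 1) = 1\<^sub>m d"
    and "g \<in> G \<Longrightarrow> h \<in> G \<Longrightarrow> \<rho> (g ** h) = \<rho> g * \<rho> h"
    and "i < d \<Longrightarrow> j < d \<Longrightarrow> continuous_on G (\<lambda>g. \<rho> g $$ (i, j))"
proof -
  have hom: "\<rho> \<in> hom (GL\<lparr>carrier := G\<rparr>) (GL_mat d)"
    using \<rho> by (simp add: linear_representation_def)
  show "g \<in> G \<Longrightarrow> \<rho> g \<in> carrier_mat d d"
    using hom by (auto simp: hom_def GL_def GL_mat_def)
  show "g \<in> G \<Longrightarrow> h \<in> G \<Longrightarrow> \<rho> (g ** h) = \<rho> g * \<rho> h"
    using hom by (auto simp: hom_def GL_def GL_mat_def)
  \<comment> \<open>Membership in \<open>hom\<close> only states multiplicativity; the identity is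
    preserved because source and target are groups.\<close>
  show "\<rho> (mat 1) = 1\<^sub>m d"
    using hom_one[OF hom subgroup.subgroup_is_group[OF G group_GL] group_GL_mat]
    by (simp add: GL_def GL_mat_def)
  show "i < d \<Longrightarrow> j < d \<Longrightarrow> continuous_on G (\<lambda>g. \<rho> g $$ (i, j))"
    using \<rho> by (simp add: linear_representation_def)
qed

text \<open>For \<open>d = 1\<close> the single entry is the constant 1, which later yields the
  constants and the pure exponentials.\<close>

lemma linear_representation_trivial:
  assumes "subgroup G GL"
  shows "linear_representation G d (\<lambda>_. 1\<^sub>m d)"
  by (rule linear_representationI[OF assms]) auto

text \<open>This is what allows approximants with different latent representations to be
  added.\<close>

lemma linear_representation_direct_sum:
  assumes G: "subgroup G GL"
    and \<rho>: "linear_representation G d \<rho>" and \<sigma>: "linear_representation G e \<sigma>"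
  shows "linear_representation G (d + e)
    (\<lambda>g. four_block_mat (\<rho> g) (0\<^sub>m d e) (0\<^sub>m e d) (\<sigma> g))"
proof (rule linear_representationI[OF G])
  \<comment> \<open>\<open>D(1)\<close> to \<open>D(4)\<close> concern \<open>\<rho>\<close> and
    \<open>D(5)\<close> to \<open>D(8)\<close> concern \<open>\<sigma>\<close>, each time in the
    order carrier, identity, product, continuity.\<close>
  note D = linear_representationD[OF G \<rho>] linear_representationD[OF G \<sigma>]
  show "four_block_mat (\<rho> g) (0\<^sub>m d e) (0\<^sub>m e d) (\<sigma> g) \<in> carrier_mat (d + e) (d + e)"
    if "g \<in> G" for g using D that by auto
  show "four_block_mat (\<rho> (mat 1)) (0\<^sub>m d e) (0\<^sub>m e d) (\<sigma> (mat 1)) = 1\<^sub>m (d + e)"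
    using D by auto
  show "four_block_mat (\<rho> (g ** h)) (0\<^sub>m d e) (0\<^sub>m e d) (\<sigma> (g ** h)) =
      four_block_mat (\<rho> g) (0\<^sub>m d e) (0\<^sub>m e d) (\<sigma> g) *
      four_block_mat (\<rho> h) (0\<^sub>m d e) (0\<^sub>m e d) (\<sigma> h)"
    if g: "g \<in> G" and h: "h \<in> G" for g h
  proof -
    have c: "\<rho> g \<in> carrier_mat d d" "\<rho> h \<in> carrier_mat d d"
        "\<sigma> g \<in> carrier_mat e e" "\<sigma> h \<in> carrier_mat e e"
      using D g h by auto
    moreover from c have "\<rho> g * \<rho> h \<in> carrier_mat d d" "\<sigma> g * \<sigma> h \<in> carrier_mat e e" by auto
    ultimately show ?thesis
      unfolding D(3)[OF g h] D(7)[OF g h]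
      by (subst mult_four_block_mat[of _ d d _ e _ e _ _ d _ e]) auto
  qed
  show "continuous_on G (\<lambda>g. four_block_mat (\<rho> g) (0\<^sub>m d e) (0\<^sub>m e d) (\<sigma> g) $$ (i, j))"
    if ij: "i < d + e" "j < d + e" for i j
  proof -
    have "four_block_mat (\<rho> g) (0\<^sub>m d e) (0\<^sub>m e d) (\<sigma> g) $$ (i, j) =
      (if i < d then if j < d then \<rho> g $$ (i, j) else 0
       else if j < d then 0 else \<sigma> g $$ (i - d, j - d))" if g: "g \<in> G" for g
      using D(1)[OF g] D(5)[OF g] ij by auto
    then have "continuous_on G (\<lambda>g. four_block_mat (\<rho> g) (0\<^sub>m d e) (0\<^sub>m e d) (\<sigma> g) $$ (i, j)) \<longleftrightarrow>
      continuous_on G (\<lambda>g. if i < d then if j < d then \<rho> g $$ (i, j) else 0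
       else if j < d then 0 else \<sigma> g $$ (i - d, j - d))"
      by (intro continuous_on_cong) auto
    then show ?thesis
      using D ij by (cases "i < d"; cases "j < d") auto
  qed
qed

section \<open>Kronecker products of representations\<close>

text \<open>An index below \<open>d * e\<close> encodes a pair by quotient and remainder modulo
  \<open>e\<close>. With explicit sizes the shape and the entry formula do not depend on the shapes
  of \<open>A\<close> and \<open>B\<close>, so they hold even at matrices outside the group, where a
  representation may take any value.\<close>

definition kronecker :: "nat \<Rightarrow> real mat \<Rightarrow> nat \<Rightarrow> real mat \<Rightarrow> real mat" where
  "kronecker d A e B = Matrix.mat (d * e) (d * e)
     (\<lambda>(i, j). A $$ (i div e, j div e) * B $$ (i mod e, j mod e))"

lemma div_mod_less_mult:
  fixes i d e :: nat
  assumes "i < d * e"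
  shows "i div e < d" "i mod e < e"
proof -
  show "i div e < d" using assms by (rule less_mult_imp_div_less)
  show "i mod e < e" using assms by (cases "e = 0") simp_all
qed

lemma mult_add_less_mult:
  fixes i d j e :: nat
  assumes "i < d" "j < e"
  shows "i * e + j < d * e"
proof -
  have "i * e + j < Suc i * e" using assms by simp
  also have "\<dots> \<le> d * e" using assms by (intro mult_le_mono1) simp
  finally show ?thesis .
qed

text \<open>The mixed-product identity: a product of sums over \<open>k < d\<close> and
  \<open>l < e\<close> is one sum over \<open>m = k * e + l\<close>.\<close>

lemma kronecker_mult:
  assumes "A \<in> carrier_mat d d" "A' \<in> carrier_mat d d" "B \<in> carrier_mat e e" "B' \<in> carrier_mat e e"
  shows "kronecker d (A * A') e (B * B') = kronecker d A e B * kronecker d A' e B'"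
proof (rule eq_matI)
  fix i j
  assume "i < dim_row (kronecker d A e B * kronecker d A' e B')"
    and "j < dim_col (kronecker d A e B * kronecker d A' e B')"
  then have ij: "i < d * e" "j < d * e" by (simp_all add: kronecker_def)
  note ij' = div_mod_less_mult[OF ij(1)] div_mod_less_mult[OF ij(2)]
  have "kronecker d (A * A') e (B * B') $$ (i, j) =
      (\<Sum>k<d. A $$ (i div e, k) * A' $$ (k, j div e)) *
      (\<Sum>l<e. B $$ (i mod e, l) * B' $$ (l, j mod e))"
    using assms ij ij' by (simp add: kronecker_def scalar_prod_def lessThan_atLeast0)
  also have "\<dots> = (\<Sum>k<d. \<Sum>l<e. A $$ (i div e, k) * A' $$ (k, j div e) *
      (B $$ (i mod e, l) * B' $$ (l, j mod e)))"
    by (simp add: sum_product)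
  also have "\<dots> = (\<Sum>m<d * e. A $$ (i div e, m div e) * A' $$ (m div e, j div e) *
      (B $$ (i mod e, m mod e) * B' $$ (m mod e, j mod e)))"
    unfolding sum.cartesian_product
    by (rule sum.reindex_bij_witness[of _ "\<lambda>m. (m div e, m mod e)" "\<lambda>(k, l). k * e + l"])
      (auto simp: div_mod_less_mult mult_add_less_mult)
  also have "\<dots> = (kronecker d A e B * kronecker d A' e B') $$ (i, j)"
    using ij by (simp add: kronecker_def scalar_prod_def lessThan_atLeast0 mult_ac)
  finally show "kronecker d (A * A') e (B * B') $$ (i, j) =
      (kronecker d A e B * kronecker d A' e B') $$ (i, j)" .
qed (simp_all add: kronecker_def)

lemma kronecker_one: "kronecker d (1\<^sub>m d) e (1\<^sub>m e) = 1\<^sub>m (d * e)"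
proof (rule eq_matI)
  fix i j assume "i < dim_row (1\<^sub>m (d * e) :: real mat)" "j < dim_col (1\<^sub>m (d * e) :: real mat)"
  then have ij: "i < d * e" "j < d * e" by simp_all
  have "i div e = j div e \<and> i mod e = j mod e \<longleftrightarrow> i = j"
    by (metis div_mult_mod_eq)
  then show "kronecker d (1\<^sub>m d) e (1\<^sub>m e) $$ (i, j) = 1\<^sub>m (d * e) $$ (i, j)"
    using ij div_mod_less_mult[OF ij(1)] div_mod_less_mult[OF ij(2)]
    by (auto simp: kronecker_def)
qed (simp_all add: kronecker_def)

text \<open>The tensor product of two representations. Its entries are the products of an entry of
  \<open>\<rho>\<close> with an entry of \<open>\<sigma>\<close>, so matrix coefficients are closed
  under multiplication.\<close>

lemma linear_representation_kronecker:
  assumes G: "subgroup G GL"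
    and \<rho>: "linear_representation G d \<rho>" and \<sigma>: "linear_representation G e \<sigma>"
  shows "linear_representation G (d * e) (\<lambda>g. kronecker d (\<rho> g) e (\<sigma> g))"
proof (rule linear_representationI[OF G])
  note D = linear_representationD[OF G \<rho>] linear_representationD[OF G \<sigma>]
  show "kronecker d (\<rho> g) e (\<sigma> g) \<in> carrier_mat (d * e) (d * e)" for g
    by (simp add: kronecker_def)
  show "kronecker d (\<rho> (mat 1)) e (\<sigma> (mat 1)) = 1\<^sub>m (d * e)"
    using D by (simp add: kronecker_one)
  show "kronecker d (\<rho> (g ** h)) e (\<sigma> (g ** h)) = kronecker d (\<rho> g) e (\<sigma> g) * kronecker d (\<rho> h) e (\<sigma> h)"
    if "g \<in> G" "h \<in> G" for g h
    using D that by (simp add: kronecker_mult)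
  show "continuous_on G (\<lambda>g. kronecker d (\<rho> g) e (\<sigma> g) $$ (i, j))" if "i < d * e" "j < d * e" for i j
    using that D div_mod_less_mult[OF that(1)] div_mod_less_mult[OF that(2)]
    by (simp add: kronecker_def continuous_on_mult)
qed

section \<open>Coordinates and the defining representation\<close>

lemma sum_from_nat_into_UNIV:
  fixes f :: "'n::finite \<Rightarrow> 'b::comm_monoid_add"
  shows "(\<Sum>i<CARD('n). f (from_nat_into UNIV i)) = (\<Sum>i\<in>UNIV. f i)"
  by (rule sum.reindex_bij_betw[OF bij_betw_from_nat_into_finite]) simp

lemma from_nat_into_UNIV_inj:
  assumes "i < CARD('n::finite)" "j < CARD('n)"
  shows "from_nat_into (UNIV :: 'n set) i = from_nat_into UNIV j \<longleftrightarrow> i = j"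
  using bij_betw_from_nat_into_finite[of "UNIV :: 'n set"] assms
  by (auto simp: bij_betw_def inj_on_def)

lemma scalar_prod_to_coords: "scalar_prod (to_coords x) (to_coords y) = inner x y"
  by (simp add: scalar_prod_def to_coords_def inner_vec_def sum_from_nat_into_UNIV
      [symmetric] lessThan_atLeast0)

definition to_mat :: "real^'k^'k \<Rightarrow> real mat" where
  "to_mat A = Matrix.mat CARD('k) CARD('k)
     (\<lambda>(i, j). vec_nth (vec_nth A (from_nat_into UNIV i)) (from_nat_into UNIV j))"

text \<open>The inclusion of \<open>G\<close> into \<open>GL\<close>, read in coordinates; its
  entries separate the points of \<open>G\<close>.\<close>

lemma linear_representation_to_mat:
  fixes G :: "(real^'k^'k) set"
  assumes G: "subgroup G GL"
  shows "linear_representation G CARD('k) to_mat"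
proof (rule linear_representationI[OF G])
  show "to_mat (mat 1 :: real^'k^'k) = 1\<^sub>m CARD('k)"
    by (rule eq_matI) (simp_all add: to_mat_def Finite_Cartesian_Product.mat_def from_nat_into_UNIV_inj)
  show "to_mat (g ** h) = to_mat g * to_mat h" for g h :: "real^'k^'k"
    by (rule eq_matI) (simp_all add: to_mat_def matrix_matrix_mult_def scalar_prod_def
      sum_from_nat_into_UNIV[symmetric] lessThan_atLeast0)
  show "continuous_on G (\<lambda>g. to_mat g $$ (i, j))" if "i < CARD('k)" "j < CARD('k)" for i j
    using that by (simp add: to_mat_def continuous_on_component)
qed (simp add: to_mat_def)

subsection \<open>Networks\<close>

text \<open>All inner weights are 1, so the kinks sit at \<open>- b k\<close> and every unit
  vanishes to the left of its kink; this suits a construction from left to right. The condition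
  \<open>w > 0\<close> matches the positive width of networks.\<close>

definition relu_spline :: "(real \<Rightarrow> real) \<Rightarrow> bool" where
  "relu_spline s \<longleftrightarrow>
     (\<exists>(w::nat)>0. \<exists>c\<^sub>0 c b. s = (\<lambda>t. c\<^sub>0 + (\<Sum>k<w. c k * relu (t + b k))))"

lemma relu_spline_const: "relu_spline (\<lambda>_. c)"
  unfolding relu_spline_def
  \<comment> \<open>The width must be positive, hence one unit with outer weight 0.\<close>
  by (rule exI[of _ 1], simp, rule exI[of _ c], rule exI[of _ "\<lambda>_. 0"], simp)

lemma relu_spline_add_relu:
  assumes "relu_spline s"
  shows "relu_spline (\<lambda>t. s t + c * relu (t + b))"
proof -
  obtain w :: nat and c\<^sub>0 c' b' where "w > 0" "s = (\<lambda>t. c\<^sub>0 + (\<Sum>k<w. c' k * relu (t + b' k)))"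
    using assms by (auto simp: relu_spline_def)
  then have "(\<lambda>t. s t + c * relu (t + b)) =
      (\<lambda>t. c\<^sub>0 + (\<Sum>k<Suc w. (c'(w := c)) k * relu (t + (b'(w := b)) k)))"
    by (auto simp: fun_eq_iff)
  then show ?thesis
    unfolding relu_spline_def by blast
qed

text \<open>Linear interpolation at equally spaced nodes. Between neighbouring nodes the interpolant
  is a convex combination of two node values, and uniform continuity puts both within
  \<open>e\<close> of \<open>f t\<close>.\<close>

lemma relu_spline_approximation:
  fixes f :: "real \<Rightarrow> real"
  assumes cont: "continuous_on {a..b} f" and "a < b" and "e > 0"
  obtains s where "relu_spline s" "\<And>t. t \<in> {a..b} \<Longrightarrow> \<bar>f t - s t\<bar> \<le> e"
proof -
  have "uniformly_continuous_on {a..b} f"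
    using cont by (rule compact_uniformly_continuous) simp
  then obtain \<delta> where \<delta>: "\<delta> > 0"
    and f: "\<And>t u. t \<in> {a..b} \<Longrightarrow> u \<in> {a..b} \<Longrightarrow> \<bar>u - t\<bar> < \<delta> \<Longrightarrow> \<bar>f u - f t\<bar> < e"
    using \<open>e > 0\<close> unfolding uniformly_continuous_on_def dist_real_def by metis
  \<comment> \<open>More than \<open>(b - a) / \<delta>\<close> pieces give a mesh \<open>h\<close>
    strictly below \<open>\<delta>\<close>, as the strict inequality in \<open>f\<close>
    requires.\<close>
  obtain N :: nat where N: "(b - a) / \<delta> < real N" using reals_Archimedean2 by blast
  have "0 < (b - a) / \<delta>" using \<open>a < b\<close> \<delta> by simp
  then have "N > 0" using N by (cases N) auto
  define h where "h = (b - a) / real N"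
  have h: "0 < h" "h < \<delta>" "real N * h = b - a"
    using \<open>N > 0\<close> \<open>a < b\<close> N \<delta> by (auto simp: h_def field_simps)
  \<comment> \<open>The partial spline is kept constant to the right of its last node, with the
    value of \<open>f\<close> there, so the next segment can be added without changing earlier
    ones.\<close>
  have "\<exists>s. relu_spline s \<and> (\<forall>t \<ge> a + real i * h. s t = f (a + real i * h)) \<and>
      (\<forall>t \<in> {a..a + real i * h}. \<bar>f t - s t\<bar> \<le> e)" if "i \<le> N" for i
    using that
  proof (induction i)
    case 0
    show ?case
      using \<open>e > 0\<close> by (intro exI[of _ "\<lambda>_. f a"]) (auto simp: relu_spline_const)
  next
    case (Suc i)
    define x where "x = a + real i * h"
    have xh: "a + real (Suc i) * h = x + h" by (simp add: x_def algebra_simps)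
    have "real (Suc i) * h \<le> real N * h" using Suc.prems h by (intro mult_right_mono) auto
    then have x: "a \<le> x" "x + h \<le> b" using h xh by (auto simp: x_def)
    obtain s where s: "relu_spline s" "\<And>t. t \<ge> x \<Longrightarrow> s t = f x"
        "\<And>t. t \<in> {a..x} \<Longrightarrow> \<bar>f t - s t\<bar> \<le> e"
      using Suc unfolding x_def by auto
    define m where "m = (f (x + h) - f x) / h"
    \<comment> \<open>A ramp of slope \<open>m\<close> starts at \<open>x\<close>, and a second one
      of slope \<open>- m\<close> flattens it again at \<open>x + h\<close>.\<close>
    define s' where "s' t = s t + m * relu (t + (- x)) + (- m) * relu (t + (- (x + h)))" for t
    have mid: "\<bar>f t - s' t\<bar> \<le> e" if t: "t \<in> {x..x + h}" for t
    proof -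
      \<comment> \<open>The relative position of \<open>t\<close> in the segment, hence the weight
        of the right node.\<close>
      define \<theta> where "\<theta> = (t - x) / h"
      have \<theta>: "0 \<le> \<theta>" "\<theta> \<le> 1" using t h by (auto simp: \<theta>_def)
      have "s' t = f x + \<theta> * (f (x + h) - f x)"
        using t s(2)[of t] by (simp add: s'_def m_def \<theta>_def relu_def)
      then have "f t - s' t = (1 - \<theta>) * (f t - f x) + \<theta> * (f t - f (x + h))"
        by (simp add: algebra_simps)
      also have "\<bar>\<dots>\<bar> \<le> (1 - \<theta>) * \<bar>f t - f x\<bar> + \<theta> * \<bar>f t - f (x + h)\<bar>"
        using \<theta> by (intro order_trans[OF abs_triangle_ineq]) (simp add: abs_mult)
      also have "\<dots> \<le> (1 - \<theta>) * e + \<theta> * e"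
        using \<theta> t x h f[of x t] f[of "x + h" t]
        by (intro add_mono mult_left_mono) auto
      finally show ?thesis by (simp add: algebra_simps)
    qed
    have "relu_spline s'"
      unfolding s'_def by (intro relu_spline_add_relu s)
    moreover have "s' t = f (x + h)" if "t \<ge> x + h" for t
    proof -
      have "s' t = f x + m * h"
        using that h s(2)[of t] by (simp add: s'_def relu_def algebra_simps)
      then show ?thesis using h by (simp add: m_def)
    qed
    moreover have "\<bar>f t - s' t\<bar> \<le> e" if t: "t \<in> {a..x + h}" for t
    proof (cases "t \<le> x")
      case True
      then have "s' t = s t" using h by (simp add: s'_def relu_def)
      then show ?thesis using s(3) True t by simp
    next
      case False
      then show ?thesis using mid t by simp
    qed
    ultimately show ?case unfolding xh by blast
  qed
  from this[of N] show ?thesis using that h by auto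
qed

section \<open>Constructions of one-hidden-layer networks\<close>

text \<open>Every row of the inner matrix is \<open>\<alpha>\<close>, so hidden unit
  \<open>k\<close> computes the \<open>k\<close>-th ReLU term of the spline; the outer matrix writes
  only to row \<open>j\<close>. Such an output makes a representation matrix return a multiple of
  its \<open>j\<close>-th column.\<close>

lemma one_hidden_layer_network_ridge:
  assumes s: "relu_spline s" and \<alpha>: "\<alpha> \<in> carrier_vec n" and j: "j < d"
  shows "one_hidden_layer_network n d (\<lambda>x. (\<gamma> * s (scalar_prod \<alpha> x)) \<cdot>\<^sub>v unit_vec d j)"
proof -
  obtain w :: nat and c\<^sub>0 c b where w: "w > 0" and s: "s = (\<lambda>t. c\<^sub>0 + (\<Sum>k<w. c k * relu (t + b k)))"
    using s by (auto simp: relu_spline_def)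
  define W\<^sub>1 where "W\<^sub>1 = Matrix.mat w n (\<lambda>(k, l). vec_index \<alpha> l)"
  define b\<^sub>1 where "b\<^sub>1 = Matrix.vec w b"
  define W\<^sub>2 where "W\<^sub>2 = Matrix.mat d w (\<lambda>(l, k). if l = j then \<gamma> * c k else 0)"
  define b\<^sub>2 where "b\<^sub>2 = (\<gamma> * c\<^sub>0) \<cdot>\<^sub>v unit_vec d j"
  have "(\<gamma> * s (scalar_prod \<alpha> x)) \<cdot>\<^sub>v unit_vec d j = W\<^sub>2 *\<^sub>v map_vec relu (W\<^sub>1 *\<^sub>v x + b\<^sub>1) + b\<^sub>2"
    if x: "x \<in> carrier_vec n" for x
  proof (rule eq_vecI)
    fix l assume "l < dim_vec (W\<^sub>2 *\<^sub>v map_vec relu (W\<^sub>1 *\<^sub>v x + b\<^sub>1) + b\<^sub>2)"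
    then have l: "l < d" by (simp add: b\<^sub>2_def)
    have hidden: "map_vec relu (W\<^sub>1 *\<^sub>v x + b\<^sub>1) = Matrix.vec w (\<lambda>k. relu (scalar_prod \<alpha> x + b k))"
    proof (rule eq_vecI)
      fix k assume "k < dim_vec (Matrix.vec w (\<lambda>k. relu (scalar_prod \<alpha> x + b k)))"
      then have k: "k < w" by simp
      then have "row W\<^sub>1 k = \<alpha>" using \<alpha> by (intro eq_vecI) (auto simp: W\<^sub>1_def)
      moreover have "dim_row W\<^sub>1 = w" by (simp add: W\<^sub>1_def)
      ultimately show "vec_index (map_vec relu (W\<^sub>1 *\<^sub>v x + b\<^sub>1)) k =
          vec_index (Matrix.vec w (\<lambda>k. relu (scalar_prod \<alpha> x + b k))) k"
        using k by (simp add: b\<^sub>1_def)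
    qed (simp add: b\<^sub>1_def)
    have "vec_index (W\<^sub>2 *\<^sub>v map_vec relu (W\<^sub>1 *\<^sub>v x + b\<^sub>1)) l =
        (\<Sum>k<w. W\<^sub>2 $$ (l, k) * relu (scalar_prod \<alpha> x + b k))"
      using l unfolding hidden by (simp add: W\<^sub>2_def scalar_prod_def[of "Matrix.vec w _"] lessThan_atLeast0)
    then show "vec_index ((\<gamma> * s (scalar_prod \<alpha> x)) \<cdot>\<^sub>v unit_vec d j) l =
        vec_index (W\<^sub>2 *\<^sub>v map_vec relu (W\<^sub>1 *\<^sub>v x + b\<^sub>1) + b\<^sub>2) l"
      using l j by (cases "l = j") (simp_all add: b\<^sub>2_def W\<^sub>2_def s sum_distrib_left algebra_simps)
  qed (simp add: W\<^sub>2_def b\<^sub>2_def)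
  moreover have "W\<^sub>1 \<in> carrier_mat w n" "b\<^sub>1 \<in> carrier_vec w" "W\<^sub>2 \<in> carrier_mat d w" "b\<^sub>2 \<in> carrier_vec d"
    by (auto simp: W\<^sub>1_def b\<^sub>1_def W\<^sub>2_def b\<^sub>2_def)
  ultimately show ?thesis
    unfolding one_hidden_layer_network_def using w by blast
qed

lemma map_vec_append: "map_vec f (x @\<^sub>v y) = map_vec f x @\<^sub>v map_vec f y"
  by (rule eq_vecI) auto

text \<open>The hidden layers are stacked, and a block diagonal outer matrix keeps the two networks
  from interacting.\<close>

lemma one_hidden_layer_network_append:
  assumes "one_hidden_layer_network n d \<phi>" "one_hidden_layer_network n e \<eta>"
  shows "one_hidden_layer_network n (d + e) (\<lambda>x. \<phi> x @\<^sub>v \<eta> x)"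
proof -
  obtain w W\<^sub>1 b\<^sub>1 W\<^sub>2 b\<^sub>2 where w: "w > 0"
    and c: "W\<^sub>1 \<in> carrier_mat w n" "b\<^sub>1 \<in> carrier_vec w" "W\<^sub>2 \<in> carrier_mat d w" "b\<^sub>2 \<in> carrier_vec d"
    and \<phi>: "\<And>x. x \<in> carrier_vec n \<Longrightarrow> \<phi> x = W\<^sub>2 *\<^sub>v map_vec relu (W\<^sub>1 *\<^sub>v x + b\<^sub>1) + b\<^sub>2"
    using assms(1) unfolding one_hidden_layer_network_def by metis
  obtain w' W\<^sub>1' b\<^sub>1' W\<^sub>2' b\<^sub>2'
    where c': "W\<^sub>1' \<in> carrier_mat w' n" "b\<^sub>1' \<in> carrier_vec w'" "W\<^sub>2' \<in> carrier_mat e w'" "b\<^sub>2' \<in> carrier_vec e"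
    and \<eta>: "\<And>x. x \<in> carrier_vec n \<Longrightarrow> \<eta> x = W\<^sub>2' *\<^sub>v map_vec relu (W\<^sub>1' *\<^sub>v x + b\<^sub>1') + b\<^sub>2'"
    using assms(2) unfolding one_hidden_layer_network_def by metis
  have "\<phi> x @\<^sub>v \<eta> x = four_block_mat W\<^sub>2 (0\<^sub>m d w') (0\<^sub>m e w) W\<^sub>2' *\<^sub>v
      map_vec relu ((W\<^sub>1 @\<^sub>r W\<^sub>1') *\<^sub>v x + (b\<^sub>1 @\<^sub>v b\<^sub>1')) + (b\<^sub>2 @\<^sub>v b\<^sub>2')"
    if x: "x \<in> carrier_vec n" for x
  proof -
    define y where "y = map_vec relu (W\<^sub>1 *\<^sub>v x + b\<^sub>1)"
    define y' where "y' = map_vec relu (W\<^sub>1' *\<^sub>v x + b\<^sub>1')"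
    have y: "y \<in> carrier_vec w" "y' \<in> carrier_vec w'"
      using c c' x by (auto simp: y_def y'_def intro!: add_carrier_vec mult_mat_vec_carrier)
    have "map_vec relu ((W\<^sub>1 @\<^sub>r W\<^sub>1') *\<^sub>v x + (b\<^sub>1 @\<^sub>v b\<^sub>1')) = y @\<^sub>v y'"
      unfolding mat_mult_append[OF c(1) c'(1) x] y_def y'_def map_vec_append[symmetric]
      using append_vec_add[OF mult_mat_vec_carrier[OF c(1) x] c(2) mult_mat_vec_carrier[OF c'(1) x] c'(2)]
      by simp
    moreover have "four_block_mat W\<^sub>2 (0\<^sub>m d w') (0\<^sub>m e w) W\<^sub>2' *\<^sub>v (y @\<^sub>v y') =
        (W\<^sub>2 *\<^sub>v y) @\<^sub>v (W\<^sub>2' *\<^sub>v y')"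
      using c c' y by (subst four_block_mat_mult_vec[of _ d w _ w' _ e]) auto
    moreover have "((W\<^sub>2 *\<^sub>v y) @\<^sub>v (W\<^sub>2' *\<^sub>v y')) + (b\<^sub>2 @\<^sub>v b\<^sub>2') = (W\<^sub>2 *\<^sub>v y + b\<^sub>2) @\<^sub>v (W\<^sub>2' *\<^sub>v y' + b\<^sub>2')"
      using c c' y by (intro append_vec_add) auto
    ultimately show ?thesis
      using \<phi>[OF x] \<eta>[OF x] by (simp add: y_def y'_def)
  qed
  moreover have "W\<^sub>1 @\<^sub>r W\<^sub>1' \<in> carrier_mat (w + w') n"
    using c c' by (rule_tac carrier_append_rows) auto
  moreover have "four_block_mat W\<^sub>2 (0\<^sub>m d w') (0\<^sub>m e w) W\<^sub>2' \<in> carrier_mat (d + e) (w + w')"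
    using c c' by auto
  moreover have "b\<^sub>1 @\<^sub>v b\<^sub>1' \<in> carrier_vec (w + w')" "b\<^sub>2 @\<^sub>v b\<^sub>2' \<in> carrier_vec (d + e)"
    using c c' by auto
  ultimately show ?thesis
    unfolding one_hidden_layer_network_def using w add_pos_nonneg[of w w'] by blast
qed

text \<open>The hidden layer holds the positive parts of \<open>x\<close> and \<open>- x\<close>,
  and \<open>W\<close> is applied to their difference. The width is \<open>d + d\<close>, which is
  positive because \<open>d > 0\<close>.\<close>

lemma one_hidden_layer_network_linear:
  assumes W: "W \<in> carrier_mat n d" and d: "d > 0"
  shows "one_hidden_layer_network d n (\<lambda>x. W *\<^sub>v x)"
proof -
  define W\<^sub>1 :: "real mat" where "W\<^sub>1 = 1\<^sub>m d @\<^sub>r (- 1\<^sub>m d)"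
  \<comment> \<open>Lower blocks with no rows reduce the four-block matrix to the block row of
    \<open>W\<close> and \<open>- W\<close>.\<close>
  define W\<^sub>2 where "W\<^sub>2 = four_block_mat W (- W) (0\<^sub>m 0 d) (0\<^sub>m 0 d)"
  have "W *\<^sub>v x = W\<^sub>2 *\<^sub>v map_vec relu (W\<^sub>1 *\<^sub>v x + 0\<^sub>v (d + d)) + 0\<^sub>v n" if x: "x \<in> carrier_vec d" for x
  proof -
    define p where "p = map_vec relu x"
    define q where "q = map_vec relu (- x)"
    have pq: "p \<in> carrier_vec d" "q \<in> carrier_vec d" using x by (auto simp: p_def q_def)
    have "W\<^sub>1 *\<^sub>v x = x @\<^sub>v (- x)"
      unfolding W\<^sub>1_def using x by (subst mat_mult_append[of _ d d _ d]) auto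
    then have "map_vec relu (W\<^sub>1 *\<^sub>v x + 0\<^sub>v (d + d)) = p @\<^sub>v q"
      using x by (simp add: map_vec_append p_def q_def)
    moreover have "W\<^sub>2 *\<^sub>v (p @\<^sub>v q) = (W *\<^sub>v p + (- W) *\<^sub>v q) @\<^sub>v (0\<^sub>m 0 d *\<^sub>v p + 0\<^sub>m 0 d *\<^sub>v q)"
      unfolding W\<^sub>2_def using W pq by (intro four_block_mat_mult_vec) auto
    moreover have "\<dots> = W *\<^sub>v (p - q)"
      using W pq by (intro eq_vecI) (auto simp: mult_minus_distrib_mat_vec)
    moreover have "p - q = x"
      using x by (intro eq_vecI) (auto simp: p_def q_def relu_def)
    ultimately show ?thesis using W x by auto
  qed
  moreover have "W\<^sub>1 \<in> carrier_mat (d + d) d"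
    unfolding W\<^sub>1_def by (rule carrier_append_rows) auto
  moreover have "W\<^sub>2 \<in> carrier_mat n (d + d)"
    using W four_block_carrier_mat[of W n d "0\<^sub>m 0 d" 0 d] by (auto simp: W\<^sub>2_def)
  moreover have "0\<^sub>v (d + d) \<in> carrier_vec (d + d)" "0\<^sub>v n \<in> carrier_vec n" by auto
  ultimately show ?thesis
    unfolding one_hidden_layer_network_def using d add_pos_pos[of d d] by blast
qed

subsection \<open>Approximation on a compact set\<close>

text \<open>A matrix as readout makes sums a matter of block matrices; it is turned into a ReLU
  network only at the end, and for that \<open>d > 0\<close> is recorded.\<close>

definition linearly_approximable ::
  "(real^'k^'k) set \<Rightarrow> (real^'n) set \<Rightarrow> ((real^'k^'k) \<times> (real^'n) \<Rightarrow> real^'n) \<Rightarrow> bool" where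
  "linearly_approximable G M F \<longleftrightarrow>
     (\<forall>\<delta>>0. \<exists>d>0. \<exists>\<rho> \<phi>. \<exists>W \<in> carrier_mat CARD('n) d.
        linear_representation G d \<rho> \<and> one_hidden_layer_network CARD('n) d \<phi> \<and>
        (\<forall>g\<in>G. \<forall>v\<in>M. norm (F (g, v) - of_coords (W *\<^sub>v (\<rho> g *\<^sub>v \<phi> (to_coords v)))) \<le> \<delta>))"

lemma linearly_approximableE:
  fixes F :: "(real^'k^'k) \<times> (real^'n) \<Rightarrow> real^'n"
  assumes "linearly_approximable G M F" "\<delta> > 0"
  obtains d \<rho> \<phi> W where "d > 0" "W \<in> carrier_mat CARD('n) d"
    "linear_representation G d \<rho>" "one_hidden_layer_network CARD('n) d \<phi>"
    "\<And>g v. g \<in> G \<Longrightarrow> v \<in> M \<Longrightarrow>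
      norm (F (g, v) - of_coords (W *\<^sub>v (\<rho> g *\<^sub>v \<phi> (to_coords v)))) \<le> \<delta>"
  using assms unfolding linearly_approximable_def by metis

lemma one_hidden_layer_network_carrier:
  "one_hidden_layer_network n d \<phi> \<Longrightarrow> x \<in> carrier_vec n \<Longrightarrow> \<phi> x \<in> carrier_vec d"
  by (auto simp: one_hidden_layer_network_def)

lemma of_coords_add:
  assumes "x \<in> carrier_vec CARD('n)" "y \<in> carrier_vec CARD('n)"
  shows "(of_coords (x + y) :: real^'n) = of_coords x + of_coords y"
  using assms to_nat_on_UNIV_less[where 'n = 'n]
  by (simp add: of_coords_def Finite_Cartesian_Product.vec_eq_iff)

text \<open>Direct sum of the representations, concatenation of the encoders, and readouts placed
  side by side; each summand gets half of the tolerance.\<close>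

lemma linearly_approximable_add:
  fixes F H :: "(real^'k^'k) \<times> (real^'n) \<Rightarrow> real^'n"
  assumes G: "subgroup G GL"
    and F: "linearly_approximable G M F" and H: "linearly_approximable G M H"
  shows "linearly_approximable G M (\<lambda>x. F x + H x)"
  unfolding linearly_approximable_def
proof (intro allI impI)
  fix \<delta> :: real assume "\<delta> > 0"
  then have \<delta>: "\<delta> / 2 > 0" by simp
  let ?n = "CARD('n)"
  obtain d \<rho> \<phi> W where d: "d > 0" and W: "W \<in> carrier_mat ?n d"
    and \<rho>: "linear_representation G d \<rho>" and \<phi>: "one_hidden_layer_network ?n d \<phi>"
    and F: "\<And>g v. g \<in> G \<Longrightarrow> v \<in> M \<Longrightarrow>
      norm (F (g, v) - of_coords (W *\<^sub>v (\<rho> g *\<^sub>v \<phi> (to_coords v)))) \<le> \<delta> / 2"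
    using linearly_approximableE[OF F \<delta>] by metis
  obtain e \<sigma> \<eta> V where V: "V \<in> carrier_mat ?n e"
    and \<sigma>: "linear_representation G e \<sigma>" and \<eta>: "one_hidden_layer_network ?n e \<eta>"
    and H: "\<And>g v. g \<in> G \<Longrightarrow> v \<in> M \<Longrightarrow>
      norm (H (g, v) - of_coords (V *\<^sub>v (\<sigma> g *\<^sub>v \<eta> (to_coords v)))) \<le> \<delta> / 2"
    using linearly_approximableE[OF H \<delta>] by metis
  define \<tau> where "\<tau> g = four_block_mat (\<rho> g) (0\<^sub>m d e) (0\<^sub>m e d) (\<sigma> g)" for g
  \<comment> \<open>Again a block row, with lower blocks that have no rows.\<close>
  define U where "U = four_block_mat W V (0\<^sub>m 0 d) (0\<^sub>m 0 e)"
  have \<tau>: "linear_representation G (d + e) \<tau>"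
    unfolding \<tau>_def by (rule linear_representation_direct_sum[OF G \<rho> \<sigma>])
  have U: "U \<in> carrier_mat ?n (d + e)"
    using four_block_carrier_mat[OF W, of "0\<^sub>m 0 e" 0 e] by (auto simp: U_def)
  have "norm (F (g, v) + H (g, v) -
      of_coords (U *\<^sub>v (\<tau> g *\<^sub>v (\<phi> (to_coords v) @\<^sub>v \<eta> (to_coords v))))) \<le> \<delta>"
    if g: "g \<in> G" and v: "v \<in> M" for g v
  proof -
    define x where "x = \<rho> g *\<^sub>v \<phi> (to_coords v)"
    define y where "y = \<sigma> g *\<^sub>v \<eta> (to_coords v)"
    have c: "\<rho> g \<in> carrier_mat d d" "\<sigma> g \<in> carrier_mat e e"
        "\<phi> (to_coords v) \<in> carrier_vec d" "\<eta> (to_coords v) \<in> carrier_vec e"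
      using linear_representationD(1)[OF G \<rho> g] linear_representationD(1)[OF G \<sigma> g]
        one_hidden_layer_network_carrier[OF \<phi> to_coords_carrier]
        one_hidden_layer_network_carrier[OF \<eta> to_coords_carrier] by auto
    then have xy: "x \<in> carrier_vec d" "y \<in> carrier_vec e"
      by (auto simp: x_def y_def)
    have "\<tau> g *\<^sub>v (\<phi> (to_coords v) @\<^sub>v \<eta> (to_coords v)) = x @\<^sub>v y"
      unfolding \<tau>_def x_def y_def using c by (rule mult_mat_vec_split)
    moreover have "U *\<^sub>v (x @\<^sub>v y) = (W *\<^sub>v x + V *\<^sub>v y) @\<^sub>v (0\<^sub>m 0 d *\<^sub>v x + 0\<^sub>m 0 e *\<^sub>v y)"
      unfolding U_def using W V xy by (intro four_block_mat_mult_vec) auto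
    moreover have "\<dots> = W *\<^sub>v x + V *\<^sub>v y"
      using W V xy by (intro eq_vecI) auto
    ultimately have "of_coords (U *\<^sub>v (\<tau> g *\<^sub>v (\<phi> (to_coords v) @\<^sub>v \<eta> (to_coords v)))) =
        (of_coords (W *\<^sub>v x) + of_coords (V *\<^sub>v y) :: real^'n)"
      using W V xy by (simp add: of_coords_add)
    moreover have "norm (F (g, v) - of_coords (W *\<^sub>v x)) \<le> \<delta> / 2"
      "norm (H (g, v) - of_coords (V *\<^sub>v y)) \<le> \<delta> / 2"
      using F[OF g v] H[OF g v] by (simp_all add: x_def y_def)
    ultimately show ?thesis
      using norm_triangle_mono[of "F (g, v) - of_coords (W *\<^sub>v x)" "\<delta> / 2"
        "H (g, v) - of_coords (V *\<^sub>v y)" "\<delta> / 2"]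
      by (simp add: algebra_simps)
  qed
  then show "\<exists>d>0. \<exists>\<rho> \<phi>. \<exists>W \<in> carrier_mat ?n d.
      linear_representation G d \<rho> \<and> one_hidden_layer_network ?n d \<phi> \<and>
      (\<forall>g\<in>G. \<forall>v\<in>M. norm (F (g, v) + H (g, v) - of_coords (W *\<^sub>v (\<rho> g *\<^sub>v \<phi> (to_coords v)))) \<le> \<delta>)"
    using d by (intro exI[of _ "d + e"] conjI exI[of _ \<tau>]
      exI[of _ "\<lambda>x. \<phi> x @\<^sub>v \<eta> x"] bexI[of _ U] \<tau> U
      one_hidden_layer_network_append[OF \<phi> \<eta>]) auto
qed

lemma linearly_approximable_limit:
  fixes F :: "(real^'k^'k) \<times> (real^'n) \<Rightarrow> real^'n"
  assumes "\<And>\<delta>. \<delta> > 0 \<Longrightarrow> \<exists>H. linearly_approximable G M H \<and> (\<forall>x\<in>G \<times> M. norm (F x - H x) \<le> \<delta>)"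
  shows "linearly_approximable G M F"
  unfolding linearly_approximable_def
proof (intro allI impI)
  fix \<delta> :: real assume "\<delta> > 0"
  then have \<delta>: "\<delta> / 2 > 0" by simp
  let ?n = "CARD('n)"
  obtain H where H: "linearly_approximable G M H"
    and FH: "\<And>g v. g \<in> G \<Longrightarrow> v \<in> M \<Longrightarrow> norm (F (g, v) - H (g, v)) \<le> \<delta> / 2"
    using assms[OF \<delta>] by auto
  obtain d \<rho> \<phi> W where d: "d > 0" and W: "W \<in> carrier_mat ?n d"
    and \<rho>: "linear_representation G d \<rho>" and \<phi>: "one_hidden_layer_network ?n d \<phi>"
    and H: "\<And>g v. g \<in> G \<Longrightarrow> v \<in> M \<Longrightarrow>
      norm (H (g, v) - of_coords (W *\<^sub>v (\<rho> g *\<^sub>v \<phi> (to_coords v)))) \<le> \<delta> / 2"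
    using linearly_approximableE[OF H \<delta>] by metis
  have "norm (F (g, v) - of_coords (W *\<^sub>v (\<rho> g *\<^sub>v \<phi> (to_coords v)))) \<le> \<delta>"
    if "g \<in> G" "v \<in> M" for g v
    using norm_triangle_mono[OF FH[OF that] H[OF that]] by simp
  then show "\<exists>d>0. \<exists>\<rho> \<phi>. \<exists>W \<in> carrier_mat ?n d.
      linear_representation G d \<rho> \<and> one_hidden_layer_network ?n d \<phi> \<and>
      (\<forall>g\<in>G. \<forall>v\<in>M. norm (F (g, v) - of_coords (W *\<^sub>v (\<rho> g *\<^sub>v \<phi> (to_coords v)))) \<le> \<delta>)"
    using d W \<rho> \<phi> by blast
qed

section \<open>A matrix coefficient times a ridge function\<close>

text \<open>The encoder puts an approximation of \<open>c * f (inner a v)\<close> on the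
  \<open>j\<close>-th unit vector, \<open>\<rho> g\<close> turns this into a multiple of its
  \<open>j\<close>-th column, and the readout moves the \<open>i\<close>-th entry to coordinate
  \<open>r\<close>.\<close>

lemma linearly_approximable_matrix_coefficient:
  fixes G :: "(real^'k^'k) set" and M :: "(real^'n) set"
  assumes G: "subgroup G GL" "compact G" and M: "compact M"
    and \<rho>: "linear_representation G d \<rho>" and ij: "i < d" "j < d"
    and f: "continuous_on UNIV f"
  shows "linearly_approximable G M
    (\<lambda>x. (c * \<rho> (fst x) $$ (i, j) * f (inner a (snd x))) *\<^sub>R axis r 1)"
  unfolding linearly_approximable_def
proof (intro allI impI)
  fix \<delta> :: real assume \<delta>: "\<delta> > 0"
  let ?n = "CARD('n)"
  have "bounded ((\<lambda>g. c * \<rho> g $$ (i, j)) ` G)"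
    using linear_representationD(4)[OF G(1) \<rho> ij] G(2)
    by (intro compact_imp_bounded compact_continuous_image continuous_intros)
  then obtain K where K: "K > 0" "\<And>g. g \<in> G \<Longrightarrow> \<bar>c * \<rho> g $$ (i, j)\<bar> \<le> K"
    by (auto simp: bounded_pos)
  have "bounded ((\<lambda>v. inner a v) ` M)"
    using M by (intro compact_imp_bounded compact_continuous_image continuous_intros)
  then obtain L where L: "L > 0" "\<And>v. v \<in> M \<Longrightarrow> \<bar>inner a v\<bar> \<le> L"
    by (auto simp: bounded_pos)
  \<comment> \<open>The spline error is multiplied by \<open>c * \<rho> g $$ (i, j)\<close>, which
    \<open>K\<close> bounds on \<open>G\<close>; hence the tolerance \<open>\<delta> / K\<close>. By
    the choice of \<open>L\<close> only arguments between \<open>- L\<close> and \<open>L\<close>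
    occur.\<close>
  obtain s where s: "relu_spline s" "\<And>t. t \<in> {- L..L} \<Longrightarrow> \<bar>f t - s t\<bar> \<le> \<delta> / K"
    using relu_spline_approximation[of "- L" L f "\<delta> / K"] f L K \<delta>
    by (metis continuous_on_subset divide_pos_pos less_trans neg_less_0_iff_less top_greatest)
  define \<phi> where "\<phi> x = (c * s (scalar_prod (to_coords a) x)) \<cdot>\<^sub>v unit_vec d j" for x
  \<comment> \<open>A single 1, in column \<open>i\<close> and in the row that the enumeration
    behind \<open>of_coords\<close> assigns to coordinate \<open>r\<close>.\<close>
  define W :: "real mat" where
    "W = Matrix.mat ?n d (\<lambda>(l, m). if l = to_nat_on (UNIV :: 'n set) r \<and> m = i then 1 else 0)"
  have \<phi>: "one_hidden_layer_network ?n d \<phi>"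
    unfolding \<phi>_def by (rule one_hidden_layer_network_ridge[OF s(1) to_coords_carrier ij(2)])
  have "norm ((c * \<rho> g $$ (i, j) * f (inner a v)) *\<^sub>R axis r 1 -
      of_coords (W *\<^sub>v (\<rho> g *\<^sub>v \<phi> (to_coords v))) :: real^'n) \<le> \<delta>"
    if g: "g \<in> G" and v: "v \<in> M" for g v
  proof -
    have \<rho>g: "\<rho> g \<in> carrier_mat d d" using linear_representationD(1)[OF G(1) \<rho> g] .
    define y where "y = \<rho> g *\<^sub>v \<phi> (to_coords v)"
    have y: "dim_vec y = d" "vec_index y i = c * \<rho> g $$ (i, j) * s (inner a v)"
      using \<rho>g ij by (auto simp: y_def \<phi>_def scalar_prod_to_coords)
    have "vec_index (W *\<^sub>v y) l = (if l = to_nat_on (UNIV :: 'n set) r then vec_index y i else 0)"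
      if "l < ?n" for l
    proof -
      have "vec_index (W *\<^sub>v y) l =
          (\<Sum>m<d. (if l = to_nat_on (UNIV :: 'n set) r \<and> m = i then 1 else 0) * vec_index y m)"
        using that y(1) by (simp add: W_def scalar_prod_def lessThan_atLeast0)
      also have "\<dots> = (\<Sum>m<d. if m = i then
          (if l = to_nat_on (UNIV :: 'n set) r then vec_index y i else 0) else 0)"
        by (rule sum.cong) auto
      finally show ?thesis using ij by simp
    qed
    then have "of_coords (W *\<^sub>v y) = (vec_index y i *\<^sub>R axis r 1 :: real^'n)"
      by (auto simp: of_coords_def Finite_Cartesian_Product.vec_eq_iff axis_def
        to_nat_on_UNIV_less)
    then have "norm ((c * \<rho> g $$ (i, j) * f (inner a v)) *\<^sub>R axis r 1 -
        of_coords (W *\<^sub>v y) :: real^'n) =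
        norm ((c * \<rho> g $$ (i, j) * (f (inner a v) - s (inner a v))) *\<^sub>R (axis r 1 :: real^'n))"
      using y(2) by (simp only: right_diff_distrib scaleR_left_diff_distrib)
    also have "\<dots> = \<bar>c * \<rho> g $$ (i, j)\<bar> * \<bar>f (inner a v) - s (inner a v)\<bar>"
      by (simp add: abs_mult)
    also have "\<dots> \<le> K * (\<delta> / K)"
    proof (intro mult_mono)
      show "\<bar>f (inner a v) - s (inner a v)\<bar> \<le> \<delta> / K"
        using L(2)[OF v] by (intro s(2)) auto
    qed (use K(1) K(2)[OF g] in auto)
    finally show ?thesis using K(1) by (simp add: y_def)
  qed
  moreover have "W \<in> carrier_mat ?n d" by (simp add: W_def)
  moreover have "d > 0" using ij by simp
  ultimately show "\<exists>d>0. \<exists>\<sigma> \<phi>. \<exists>W \<in> carrier_mat ?n d.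
      linear_representation G d \<sigma> \<and> one_hidden_layer_network ?n d \<phi> \<and>
      (\<forall>g\<in>G. \<forall>v\<in>M. norm ((c * \<rho> (fst (g, v)) $$ (i, j) * f (inner a (snd (g, v)))) *\<^sub>R axis r 1 -
        of_coords (W *\<^sub>v (\<sigma> g *\<^sub>v \<phi> (to_coords v))) :: real^'n) \<le> \<delta>)"
    using \<rho> \<phi> unfolding fst_conv snd_conv by blast
qed

text \<open>Ridge functions with exponential profile are used because, unlike those with ReLU
  profile, they are closed under multiplication.\<close>

inductive rep_exp_sum ::
  "(real^'k^'k) set \<Rightarrow> ((real^'k^'k) \<times> (real^'n) \<Rightarrow> real) \<Rightarrow> bool" for G where
  coefficient: "linear_representation G d \<rho> \<Longrightarrow> i < d \<Longrightarrow> j < d \<Longrightarrow>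
    rep_exp_sum G (\<lambda>x. c * \<rho> (fst x) $$ (i, j) * exp (inner a (snd x)))"
| add: "rep_exp_sum G f \<Longrightarrow> rep_exp_sum G h \<Longrightarrow> rep_exp_sum G (\<lambda>x. f x + h x)"

section \<open>Density by Stone-Weierstrass\<close>

text \<open>Distributivity, as an induction on each factor, reduces the claim to two generators.
  Their coefficients multiply to an entry of the Kronecker product, and their exponents add up to
  \<open>inner (a + a') v\<close>.\<close>

lemma rep_exp_sum_mult:
  assumes G: "subgroup G GL" and f: "rep_exp_sum G f" and h: "rep_exp_sum G h"
  shows "rep_exp_sum G (\<lambda>x. f x * h x)"
  using f
proof induction
  case (coefficient d \<rho> i j c a)
  from h show ?case
  proof induction
    case (coefficient e \<sigma> k l c' a')
    \<comment> \<open>The position in the Kronecker product that decodes to the entries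
      \<open>(i, j)\<close> and \<open>(k, l)\<close>.\<close>
    let ?I = "(i * e + k, j * e + l)"
    have "kronecker d (\<rho> g) e (\<sigma> g) $$ ?I = \<rho> g $$ (i, j) * \<sigma> g $$ (k, l)" for g
      using \<open>i < d\<close> \<open>j < d\<close> coefficient by (simp add: kronecker_def mult_add_less_mult)
    then have "(\<lambda>x. (c * \<rho> (fst x) $$ (i, j) * exp (inner a (snd x))) *
          (c' * \<sigma> (fst x) $$ (k, l) * exp (inner a' (snd x)))) =
        (\<lambda>x. (c * c') * kronecker d (\<rho> (fst x)) e (\<sigma> (fst x)) $$ ?I * exp (inner (a + a') (snd x)))"
      by (simp add: fun_eq_iff inner_add_left exp_add mult_ac)
    then show ?case
      using rep_exp_sum.coefficient[OF linear_representation_kronecker[OF G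
        \<open>linear_representation G d \<rho>\<close> \<open>linear_representation G e \<sigma>\<close>], of "i * e + k" "j * e + l"]
        \<open>i < d\<close> \<open>j < d\<close> coefficient by (simp add: mult_add_less_mult)
  next
    case (add f h)
    then show ?case by (simp add: distrib_left rep_exp_sum.add)
  qed
next
  case (add f h)
  then show ?case by (simp add: distrib_right rep_exp_sum.add)
qed

text \<open>The sums form an algebra of continuous functions that contains the constants. Points
  with different group components are separated by a matrix entry, all others by the exponential of
  a coordinate.\<close>

lemma rep_exp_sum_dense:
  fixes G :: "(real^'k^'k) set" and M :: "(real^'n) set"
  assumes G: "subgroup G GL" "compact G" and M: "compact M"
    and F: "continuous_on (G \<times> M) F" and \<delta>: "\<delta> > 0"
  shows "\<exists>f. rep_exp_sum G f \<and> (\<forall>x \<in> G \<times> M. \<bar>F x - f x\<bar> < \<delta>)"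
proof (rule Stone_Weierstrass_HOL[of "G \<times> M" "rep_exp_sum G"])
  show "compact (G \<times> M)" using G M by (simp add: compact_Times)
  show "rep_exp_sum G (\<lambda>x. c)" for c
    \<comment> \<open>The trivial representation of dimension 1 together with exponent
      \<open>a = 0\<close>.\<close>
    using coefficient[OF linear_representation_trivial[OF G(1), of 1], of 0 0 c 0] by simp
  show "continuous_on (G \<times> M) f" if "rep_exp_sum G f" for f
    using that
  proof induction
    case (coefficient d \<rho> i j c a)
    have "continuous_on (G \<times> M) (\<lambda>x. \<rho> (fst x) $$ (i, j))"
      by (rule continuous_on_compose2[OF linear_representationD(4)[OF G(1) coefficient]])
        (auto intro: continuous_intros)
    then show ?case by (intro continuous_intros)
  qed (intro continuous_intros)
  show "rep_exp_sum G (\<lambda>x. f x + h x)" if "rep_exp_sum G f \<and> rep_exp_sum G h" for f h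
    using that by (simp add: add)
  show "rep_exp_sum G (\<lambda>x. f x * h x)" if "rep_exp_sum G f \<and> rep_exp_sum G h" for f h
    using that by (simp add: rep_exp_sum_mult[OF G(1)])
  show "\<exists>f. rep_exp_sum G f \<and> f x \<noteq> f y" if xy: "x \<in> G \<times> M \<and> y \<in> G \<times> M \<and> x \<noteq> y"
    for x y :: "(real^'k^'k) \<times> (real^'n)"
  proof (cases "fst x = fst y")
    case True
    then obtain r where r: "vec_nth (snd x) r \<noteq> vec_nth (snd y) r"
      using xy by (auto simp: prod_eq_iff Finite_Cartesian_Product.vec_eq_iff)
    have "rep_exp_sum G (\<lambda>x. exp (inner (axis r 1) (snd x)))"
      using coefficient[OF linear_representation_trivial[OF G(1), of 1], of 0 0 1 "axis r 1"]
      by simp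
    moreover have "exp (inner (axis r 1) (snd x)) \<noteq> exp (inner (axis r 1) (snd y))"
      using r by (simp add: inner_axis')
    ultimately show ?thesis by blast
  next
    case False
    then obtain p q where pq: "vec_nth (vec_nth (fst x) p) q \<noteq> vec_nth (vec_nth (fst y) p) q"
      by (auto simp: Finite_Cartesian_Product.vec_eq_iff)
    let ?i = "to_nat_on (UNIV :: 'k set)"
    have "to_mat A $$ (?i p, ?i q) = vec_nth (vec_nth A p) q" for A :: "real^'k^'k"
      by (simp add: to_mat_def to_nat_on_UNIV_less)
    then have "rep_exp_sum G (\<lambda>x :: (real^'k^'k) \<times> (real^'n). vec_nth (vec_nth (fst x) p) q)"
      \<comment> \<open>With \<open>a = 0\<close> the exponential factor is 1, which leaves the bare
        matrix entry.\<close>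
      using coefficient[OF linear_representation_to_mat[OF G(1)], of "?i p" "?i q" 1 0]
      by (simp add: to_nat_on_UNIV_less)
    then show ?thesis using pq by blast
  qed
qed (use F \<delta> in auto)

text \<open>Each coordinate of \<open>F\<close> is a uniform limit of sums of generators, each
  generator is approximable along a fixed axis, and the coordinates are finally added up.\<close>

lemma linearly_approximable_continuous:
  fixes G :: "(real^'k^'k) set" and M :: "(real^'n) set" and F :: "(real^'k^'k) \<times> (real^'n) \<Rightarrow> real^'n"
  assumes G: "subgroup G GL" "compact G" and M: "compact M" and F: "continuous_on (G \<times> M) F"
  shows "linearly_approximable G M F"
proof -
  have sum: "linearly_approximable G M (\<lambda>x. f x *\<^sub>R axis r 1)" if "rep_exp_sum G f" for f r
    using that
  proof induction
    case (coefficient d \<rho> i j c a)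
    then show ?case
      by (intro linearly_approximable_matrix_coefficient[OF G M]) (auto intro: continuous_intros)
  next
    case (add f h)
    then show ?case by (simp add: scaleR_left_distrib linearly_approximable_add[OF G(1)])
  qed
  have component: "linearly_approximable G M (\<lambda>x. vec_nth (F x) r *\<^sub>R axis r 1)" for r
  proof (rule linearly_approximable_limit)
    fix \<delta> :: real assume "\<delta> > 0"
    moreover have "continuous_on (G \<times> M) (\<lambda>x. vec_nth (F x) r)"
      using F by (rule continuous_on_component)
    ultimately obtain f where f: "rep_exp_sum G f" "\<And>x. x \<in> G \<times> M \<Longrightarrow> \<bar>vec_nth (F x) r - f x\<bar> < \<delta>"
      using rep_exp_sum_dense[OF G M] by metis
    have "norm (vec_nth (F x) r *\<^sub>R axis r 1 - f x *\<^sub>R axis r 1 :: real^'n) \<le> \<delta>"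
      if "x \<in> G \<times> M" for x
      using f(2)[OF that] by (simp flip: scaleR_left_diff_distrib)
    then show "\<exists>H. linearly_approximable G M H \<and>
        (\<forall>x\<in>G \<times> M. norm (vec_nth (F x) r *\<^sub>R axis r 1 - H x) \<le> \<delta>)"
      using sum[OF f(1)] by blast
  qed
  \<comment> \<open>Closure under addition is binary, so the sum over coordinates goes by induction
    on finite index sets.\<close>
  have "linearly_approximable G M (\<lambda>x. \<Sum>r\<in>R. vec_nth (F x) r *\<^sub>R axis r 1)" if "finite R" for R
    using that
  proof induction
    case empty
    show ?case
      \<comment> \<open>The empty sum is a generator with scalar factor
        \<open>c = 0\<close>.\<close>
      using sum[OF coefficient[OF linear_representation_trivial[OF G(1), of 1], of 0 0 0 0]] by simp
  next
    case (insert r R)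
    then show ?case by (simp add: linearly_approximable_add[OF G(1) component])
  qed
  from this[of UNIV] show ?thesis
    by (simp add: basis_expansion flip: scalar_mult_eq_scaleR)
qed

theorem theorem4p1:
  fixes G :: "(real^'k^'k) set"
    and M :: "(real^'n) set"
    and \<pi>' :: "(real^'k^'k) \<times> (real^'n) \<Rightarrow> real^'n"
  assumes Lie_group: "matrix_Lie_group G" and compact_G: "compact G"
    and submanifold: "\<exists>m. embedded_submanifold m M" and compact_M: "compact M"
    and action: "matrix_group_action G M \<pi>'"
    and continuous: "continuous_on (G \<times> M) \<pi>'"
    and smooth: "smooth_map_on (G \<times> M) \<pi>'"
    and free: "free_action G M \<pi>'"
    and proper: "proper_action G M \<pi>'"
    and simply_connected: "simply_connected_space (orbit_space G M \<pi>')"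
  shows "\<forall>B \<epsilon>. B \<subseteq> G \<and> bounded B \<and> \<epsilon> > 0 \<longrightarrow>
    (\<exists>d>0. \<exists>\<pi> \<phi> \<psi>.
       linear_representation G d \<pi> \<and>
       one_hidden_layer_network CARD('n) d \<phi> \<and>
       one_hidden_layer_network d CARD('n) \<psi> \<and>
       (SUP g\<in>B. SUP v\<in>M.
          ereal (norm (\<pi>' (g, v) - of_coords (\<psi> (\<pi> g *\<^sub>v \<phi> (to_coords v)))))) \<le> ereal \<epsilon>)"
proof (intro allI impI)
  fix B :: "(real^'k^'k) set" and \<epsilon> :: real
  assume B: "B \<subseteq> G \<and> bounded B \<and> \<epsilon> > 0"
  \<comment> \<open>The estimate is obtained on all of \<open>G\<close> and then restricted to
    \<open>B\<close>.\<close>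
  have "linearly_approximable G M \<pi>'"
    using Lie_group compact_G compact_M continuous
    by (intro linearly_approximable_continuous) (auto simp: matrix_Lie_group_def)
  then obtain d \<rho> \<phi> W where *: "d > 0" "W \<in> carrier_mat CARD('n) d"
    "linear_representation G d \<rho>" "one_hidden_layer_network CARD('n) d \<phi>"
    and approx: "\<And>g v. g \<in> G \<Longrightarrow> v \<in> M \<Longrightarrow>
      norm (\<pi>' (g, v) - of_coords (W *\<^sub>v (\<rho> g *\<^sub>v \<phi> (to_coords v)))) \<le> \<epsilon>"
    using B linearly_approximableE by metis
  \<comment> \<open>In the extended reals a pointwise bound suffices, also when \<open>B\<close> or
    \<open>M\<close> is empty and the supremum is minus infinity.\<close>
  have "(SUP g\<in>B. SUP v\<in>M. ereal (norm (\<pi>' (g, v) -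
      of_coords (W *\<^sub>v (\<rho> g *\<^sub>v \<phi> (to_coords v)))))) \<le> ereal \<epsilon>"
    using B approx by (intro SUP_least) auto
  then show "\<exists>d>0. \<exists>\<pi> \<phi> \<psi>.
       linear_representation G d \<pi> \<and>
       one_hidden_layer_network CARD('n) d \<phi> \<and>
       one_hidden_layer_network d CARD('n) \<psi> \<and>
       (SUP g\<in>B. SUP v\<in>M.
          ereal (norm (\<pi>' (g, v) - of_coords (\<psi> (\<pi> g *\<^sub>v \<phi> (to_coords v)))))) \<le> ereal \<epsilon>"
    \<comment> \<open>The decoder \<open>\<psi>\<close> is the linear readout \<open>W\<close>, now
      seen as a network.\<close>
    using * one_hidden_layer_network_linear[OF *(2,1)] by blast
qed

end
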